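(* Let $(X,T)$ be a topological dynamical system and $s>0$. Let $\Phi=(\varphi_n)_{n\in\mathbb N}$ and $\Psi=(\psi_n)_{n\in\mathbb N}$ be two almost additive sequences for $T$. Then (1) $PD_3(s,T,\Phi+\Psi)\le PD_3(s,T,\Phi)+PD_3(s,T,\Psi)$. (2) For $i=1,2,3,4$: $PD_i(s,T,\lambda\Phi)\le\lambda\cdot PD_i(s,T,\Phi)$ if $\lambda\ge1$, and $PD_i(s,T,\lambda\Phi)\ge\lambda\cdot PD_i(s,T,\Phi)$ if $0\le\lambda\le1$.
   Context: A topological dynamical system $(X,T)$ (or $(X,d,T)$) is a compact metric space $(X,d)$ with a continuous map $T:X\to X$. A sequence $\Phi=(\varphi_n)_{n\in\mathbb N}$ ($\mathbb N=\{1,2,\dots\}$) of continuous functions $\varphi_n:X\to\mathbb R$ is almost additive for $T$ if there is a constant $C>0$ with $$-C+\varphi_n(x)+\varphi_m(T^n x)\le\varphi_{n+m}(x)\le\varphi_n(x)+\varphi_m(T^n x)+C$$ for all $n,m\in\mathbb N$, $x\in X$. Write $\Phi+\Psi=(\varphi_n+\psi_n)_{n\in\mathbb N}$ and $\lambda\Phi=(\lambda\varphi_n)_{n\in\mathbb N}$. Let $\mathcal C_X$ be the set of finite open covers of $X$; for $\alpha\in\mathcal C_X$, $\bigvee_{i=0}^{n-1}T^{-i}\alpha=\{A_0\cap T^{-1}A_1\cap\dots\cap T^{-(n-1)}A_{n-1}:A_j\in\alpha\}$. Let $d_n(x,y)=\max_{0\le j<n}d(T^jx,T^jy)$. $F\subseteq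 X$ is $(n,\epsilon)$-spanning if for each $x\in X$ there is $y\in F$ with $d_n(x,y)<\epsilon$; $E\subseteq X$ is $(n,\epsilon)$-separated if $d_n(x,y)>\epsilon$ for all distinct $x,y\in E$. Put - $q_n(T,\Phi,\alpha)=\inf\{\sum_{B\in\beta}\inf_{x\in B}e^{\varphi_n(x)}:\beta\text{ a finite subcover of }\bigvee_{i=0}^{n-1}T^{-i}\alpha\}$, - $p_n(T,\Phi,\alpha)=\inf\{\sum_{B\in\beta}\sup_{x\in B}e^{\varphi_n(x)}:\beta\text{ a finite subcover of }\bigvee_{i=0}^{n-1}T^{-i}\alpha\}$, - $Q_n(T,\Phi,\epsilon)=\inf\{\sum_{x\in F}e^{\varphi_n(x)}:F\text{ is }(n,\epsilon)\text{-spanning}\}$, - $P_n(T,\Phi,\epsilon)=\sup\{\sum_{x\in E}e^{\varphi_n(x)}:E\text{ is }(n,\epsilon)\text{-separated}\}$. The $s$-topological pressures, with values in $[-\infty,+\infty]$, are $PD_1(s,T,\Phi)=\sup_{\alpha\in\mathcal C_X}\limsup_{n\to\infty}\frac1{n^s}\log q_n(T,\Phi,\alpha)$, $PD_2(s,T,\Phi)=\lim_{\epsilon\to0}\limsup_{n\to\infty}\frac1{n^s}\log Q_n(T,\Phi,\epsilon)$, $PD_3(s,T,\Phi)=\lim_{\epsilon\to0}\limsup_{n\to\infty}\frac1{n^s}\log P_n(T,\Phi,\epsilon)$, $PD_4(s,T,\Phi)=\sup_{\alpha\in\mathcal C_X}\limsup_{n\to\infty}\frac1{n^s}\log p_n(T,\Phi,\alpha)$.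 *)

theory Defs
  imports "HOL-Analysis.Analysis"
begin

text \<open>
  The phase space is a compact subset \<open>X\<close> of a metric space type. As usual it is nonempty: for
  empty \<open>X\<close> all the quantities below would be \<open>log 0 = -\<infinity>\<close>.
\<close>

definition topological_dynamical_system :: "'a::metric_space set \<Rightarrow> ('a \<Rightarrow> 'a) \<Rightarrow> bool" where
  "topological_dynamical_system X T \<longleftrightarrow>
     compact X \<and> X \<noteq> {} \<and> continuous_on X T \<and> T ` X \<subseteq> X"

text \<open>
  Sequences are indexed by \<open>{1,2,\<dots>}\<close>; the entry at index \<open>0\<close> is unconstrained and does not
  influence the pressures, which are upper limits as \<open>n\<close> tends to infinity.
\<close>

definition almost_additive ::
  "'a::metric_space set \<Rightarrow> ('a \<Rightarrow> 'a) \<Rightarrow> (nat \<Rightarrow> 'a \<Rightarrow> real) \<Rightarrow> bool" where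
  "almost_additive X T \<phi> \<longleftrightarrow>
     (\<forall>n\<ge>1. continuous_on X (\<phi> n)) \<and>
     (\<exists>C>0. \<forall>n\<ge>1. \<forall>m\<ge>1. \<forall>x\<in>X.
        - C + \<phi> n x + \<phi> m ((T ^^ n) x) \<le> \<phi> (n + m) x \<and>
        \<phi> (n + m) x \<le> \<phi> n x + \<phi> m ((T ^^ n) x) + C)"

definition finite_open_covers :: "'a::metric_space set \<Rightarrow> 'a set set set" where
  "finite_open_covers X =
     {\<alpha>. finite \<alpha> \<and> (\<forall>A\<in>\<alpha>. openin (top_of_set X) A) \<and> \<Union>\<alpha> = X}"

definition cover_join :: "'a set \<Rightarrow> ('a \<Rightarrow> 'a) \<Rightarrow> 'a set set \<Rightarrow> nat \<Rightarrow> 'a set set" where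
  "cover_join X T \<alpha> n = {X \<inter> (\<Inter>i<n. (T ^^ i) -` A i) | A. \<forall>i<n. A i \<in> \<alpha>}"

definition finite_subcovers :: "'a set \<Rightarrow> 'a set set \<Rightarrow> 'a set set set" where
  "finite_subcovers X \<gamma> = {\<beta>. finite \<beta> \<and> \<beta> \<subseteq> \<gamma> \<and> \<Union>\<beta> = X}"

definition bowen_dist :: "('a::metric_space \<Rightarrow> 'a) \<Rightarrow> nat \<Rightarrow> 'a \<Rightarrow> 'a \<Rightarrow> real" where
  "bowen_dist T n x y = (MAX j\<in>{..<n}. dist ((T ^^ j) x) ((T ^^ j) y))"

definition spanning_set ::
  "'a::metric_space set \<Rightarrow> ('a \<Rightarrow> 'a) \<Rightarrow> nat \<Rightarrow> real \<Rightarrow> 'a set \<Rightarrow> bool" where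
  "spanning_set X T n \<epsilon> F \<longleftrightarrow> F \<subseteq> X \<and> (\<forall>x\<in>X. \<exists>y\<in>F. bowen_dist T n x y < \<epsilon>)"

definition separated_set ::
  "'a::metric_space set \<Rightarrow> ('a \<Rightarrow> 'a) \<Rightarrow> nat \<Rightarrow> real \<Rightarrow> 'a set \<Rightarrow> bool" where
  "separated_set X T n \<epsilon> E \<longleftrightarrow>
     E \<subseteq> X \<and> (\<forall>x\<in>E. \<forall>y\<in>E. x \<noteq> y \<longrightarrow> bowen_dist T n x y > \<epsilon>)"

text \<open>
  The partition sums take values in \<open>[0,\<infinity>]\<close>. Over the empty set the infimum is \<open>\<infinity>\<close> and the
  supremum is \<open>0\<close>, so an empty member of a subcover does not affect \<open>q_sum\<close> and \<open>p_sum\<close>.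
  The sets \<open>F\<close> and \<open>E\<close> may be infinite, hence the unordered infinite sums.
\<close>

definition q_sum ::
  "'a set \<Rightarrow> ('a \<Rightarrow> 'a) \<Rightarrow> (nat \<Rightarrow> 'a \<Rightarrow> real) \<Rightarrow> 'a set set \<Rightarrow> nat \<Rightarrow> ennreal" where
  "q_sum X T \<phi> \<alpha> n =
     (INF \<beta>\<in>finite_subcovers X (cover_join X T \<alpha> n). \<Sum>B\<in>\<beta>. INF x\<in>B. ennreal (exp (\<phi> n x)))"

definition p_sum ::
  "'a set \<Rightarrow> ('a \<Rightarrow> 'a) \<Rightarrow> (nat \<Rightarrow> 'a \<Rightarrow> real) \<Rightarrow> 'a set set \<Rightarrow> nat \<Rightarrow> ennreal" where
  "p_sum X T \<phi> \<alpha> n =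
     (INF \<beta>\<in>finite_subcovers X (cover_join X T \<alpha> n). \<Sum>B\<in>\<beta>. SUP x\<in>B. ennreal (exp (\<phi> n x)))"

definition Q_sum ::
  "'a::metric_space set \<Rightarrow> ('a \<Rightarrow> 'a) \<Rightarrow> (nat \<Rightarrow> 'a \<Rightarrow> real) \<Rightarrow> real \<Rightarrow> nat \<Rightarrow> ennreal" where
  "Q_sum X T \<phi> \<epsilon> n = (INF F\<in>{F. spanning_set X T n \<epsilon> F}. \<Sum>\<^sub>\<infinity>x\<in>F. ennreal (exp (\<phi> n x)))"

definition P_sum ::
  "'a::metric_space set \<Rightarrow> ('a \<Rightarrow> 'a) \<Rightarrow> (nat \<Rightarrow> 'a \<Rightarrow> real) \<Rightarrow> real \<Rightarrow> nat \<Rightarrow> ennreal" where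
  "P_sum X T \<phi> \<epsilon> n = (SUP E\<in>{E. separated_set X T n \<epsilon> E}. \<Sum>\<^sub>\<infinity>x\<in>E. ennreal (exp (\<phi> n x)))"

definition ln_ennreal :: "ennreal \<Rightarrow> ereal" where
  "ln_ennreal a = (if a = 0 then -\<infinity> else if a = \<infinity> then \<infinity> else ereal (ln (enn2real a)))"

definition growth_rate :: "real \<Rightarrow> (nat \<Rightarrow> ennreal) \<Rightarrow> ereal" where
  "growth_rate s a = limsup (\<lambda>n. ereal (1 / real n powr s) * ln_ennreal (a n))"

text \<open>
  The limits for \<open>\<epsilon>\<close> tending to \<open>0\<close> are taken in the extended reals, where they exist because
  \<open>Q_sum\<close> and \<open>P_sum\<close> are antimonotone in \<open>\<epsilon>\<close>.
\<close>

definition PD1 ::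
  "'a::metric_space set \<Rightarrow> real \<Rightarrow> ('a \<Rightarrow> 'a) \<Rightarrow> (nat \<Rightarrow> 'a \<Rightarrow> real) \<Rightarrow> ereal" where
  "PD1 X s T \<phi> = (SUP \<alpha>\<in>finite_open_covers X. growth_rate s (q_sum X T \<phi> \<alpha>))"

definition PD2 ::
  "'a::metric_space set \<Rightarrow> real \<Rightarrow> ('a \<Rightarrow> 'a) \<Rightarrow> (nat \<Rightarrow> 'a \<Rightarrow> real) \<Rightarrow> ereal" where
  "PD2 X s T \<phi> = Lim (at_right 0) (\<lambda>\<epsilon>. growth_rate s (Q_sum X T \<phi> \<epsilon>))"

definition PD3 ::
  "'a::metric_space set \<Rightarrow> real \<Rightarrow> ('a \<Rightarrow> 'a) \<Rightarrow> (nat \<Rightarrow> 'a \<Rightarrow> real) \<Rightarrow> ereal" where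
  "PD3 X s T \<phi> = Lim (at_right 0) (\<lambda>\<epsilon>. growth_rate s (P_sum X T \<phi> \<epsilon>))"

definition PD4 ::
  "'a::metric_space set \<Rightarrow> real \<Rightarrow> ('a \<Rightarrow> 'a) \<Rightarrow> (nat \<Rightarrow> 'a \<Rightarrow> real) \<Rightarrow> ereal" where
  "PD4 X s T \<phi> = (SUP \<alpha>\<in>finite_open_covers X. growth_rate s (p_sum X T \<phi> \<alpha>))"

text \<open>
  Conventions of \<^typ>\<open>ereal\<close> for arithmetic on pressures: \<open>0 * (\<plusminus>\<infinity>) = 0\<close> and
  \<open>\<infinity> + (-\<infinity>) = (-\<infinity>) + \<infinity> = \<infinity>\<close>. In particular, an upper bound by a sum of two pressures carries
  no information when that sum is of the undefined form \<open>\<infinity> - \<infinity>\<close>.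
\<close>

end

theory Submission
  imports Defs
begin

text \<open>
  For \<open>l \<ge> 1\<close> one has \<open>(\<Sum>i. a\<^sub>i powr l) \<le> (\<Sum>i. a\<^sub>i) powr l\<close>, so each partition sum of \<open>l \<Phi>\<close> is at most
  the \<open>l\<close>-th power of that of \<open>\<Phi>\<close>. On the logarithmic scale this is the relation
  \<open>ln b \<le> l * ln a\<close> between elements of \<open>[0,\<infinity>]\<close>, which is stable under infima, suprema and sums;
  it therefore passes to all four pressures at once. The case \<open>0 < l \<le> 1\<close> is the case \<open>1 / l\<close> applied
  to \<open>l \<Phi>\<close>, and for \<open>l = 0\<close> the sums are at least \<open>1\<close>. Likewise \<open>\<Sum>i. a\<^sub>i b\<^sub>i \<le> (\<Sum>i. a\<^sub>i) (\<Sum>i. b\<^sub>i)\<close> gives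
  the bound for \<open>\<Phi> + \<Psi>\<close>.
\<close>

section \<open>The extended logarithm\<close>

text \<open>The inverse of \<open>ln_ennreal\<close>, making the two extended ranges order
  isomorphic.\<close>

definition exp_ennreal :: "ereal \<Rightarrow> ennreal" where
  "exp_ennreal y = (if y = \<infinity> then \<infinity> else if y = -\<infinity> then 0 else ennreal (exp (real_of_ereal y)))"

text \<open>Together with \<open>le_ln_ennreal_iff\<close> this lets bounds on suprema and infima be
  checked inside the logarithm, without a continuity argument.\<close>

lemma ln_ennreal_le_iff: "ln_ennreal a \<le> y \<longleftrightarrow> a \<le> exp_ennreal y"
proof (cases "a = 0 \<or> a = \<infinity> \<or> \<bar>y\<bar> = \<infinity>")
  case True
  then show ?thesis
    by (cases y; cases a) (auto simp: ln_ennreal_def exp_ennreal_def top_unique)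
next
  case False
  then obtain r t where "a = ennreal r" "r > 0" "y = ereal t"
    by (cases y; cases a) (auto simp: order.order_iff_strict)
  then show ?thesis
    using ln_le_cancel_iff[of r "exp t"] by (simp add: ln_ennreal_def exp_ennreal_def)
qed

lemma le_ln_ennreal_iff: "y \<le> ln_ennreal a \<longleftrightarrow> exp_ennreal y \<le> a"
proof (cases "a = 0 \<or> a = \<infinity> \<or> \<bar>y\<bar> = \<infinity>")
  case True
  then show ?thesis
    by (cases y; cases a) (auto simp: ln_ennreal_def exp_ennreal_def top_unique)
next
  case False
  then obtain r t where "a = ennreal r" "r > 0" "y = ereal t"
    by (cases y; cases a) (auto simp: order.order_iff_strict)
  then show ?thesis by (simp add: ln_ennreal_def exp_ennreal_def ln_ge_iff)
qed

lemma ln_ennreal_mono: "a \<le> b \<Longrightarrow> ln_ennreal a \<le> ln_ennreal b"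
  by (meson ln_ennreal_le_iff order_refl order_trans)

lemma ln_ennreal_exp: "ln_ennreal (ennreal (exp x)) = ereal x"
  by (simp add: ln_ennreal_def ennreal_eq_0_iff not_le)

text \<open>Equality fails at \<open>0 * \<infinity> = 0\<close>: the left side is then
  \<open>-\<infinity>\<close>, but \<open>-\<infinity> + \<infinity> = \<infinity>\<close> on the
  right.\<close>

lemma ln_ennreal_mult_le: "ln_ennreal (a * b) \<le> ln_ennreal a + ln_ennreal b"
proof (cases "a = 0 \<or> b = 0 \<or> a = \<infinity> \<or> b = \<infinity>")
  case True
  then show ?thesis by (auto simp: ln_ennreal_def)
next
  case False
  then obtain x y where xy: "a = ennreal x" "b = ennreal y" "x > 0" "y > 0"
    by (cases a; cases b) (auto simp: order.order_iff_strict)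
  then have "a * b = ennreal (x * y)" by (simp add: ennreal_mult)
  with xy show ?thesis by (simp add: ln_ennreal_def ln_mult)
qed

text \<open>Split off one factor of each base; since \<open>l - 1 \<ge> 0\<close>, each remaining
  power is at most \<open>(a + b) powr (l - 1)\<close>.\<close>

lemma powr_superadditive:
  fixes a b l :: real
  assumes "a > 0" "b > 0" "l \<ge> 1"
  shows "a powr l + b powr l \<le> (a + b) powr l"
proof -
  have split: "c powr l = c * c powr (l - 1)" if "c > 0" for c :: real
    using that by (simp add: powr_diff)
  have "a * a powr (l - 1) + b * b powr (l - 1)
      \<le> a * (a + b) powr (l - 1) + b * (a + b) powr (l - 1)"
    using assms by (intro add_mono mult_left_mono powr_mono2) auto
  with assms show ?thesis by (simp add: split distrib_right)
qed

text \<open>The logarithmic form of \<open>powr_superadditive\<close>, extended to the values 0 and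
  \<open>\<infinity>\<close>.\<close>

lemma ln_ennreal_add_le:
  assumes "l \<ge> 1" "ln_ennreal b \<le> ereal l * ln_ennreal a" "ln_ennreal b' \<le> ereal l * ln_ennreal a'"
  shows "ln_ennreal (b + b') \<le> ereal l * ln_ennreal (a + a')"
proof -
  \<comment> \<open>An infinite value makes the right side infinite. If \<open>a = 0\<close>, the
    bound on \<open>ln_ennreal b\<close> is \<open>-\<infinity>\<close>, which forces
    \<open>b = 0\<close>. Real powers handle the rest.\<close>
  consider "a = \<infinity> \<or> a' = \<infinity>" | "a = 0" | "a' = 0"
    | "a \<noteq> \<infinity>" "a' \<noteq> \<infinity>" "a \<noteq> 0" "a' \<noteq> 0" by blast
  then show ?thesis
  proof cases
    case 1
    with assms(1) show ?thesis by (auto simp: ln_ennreal_def)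
  next
    case 2
    with assms have "b = 0" by (auto simp: ln_ennreal_def split: if_splits)
    with 2 assms show ?thesis by simp
  next
    case 3
    with assms have "b' = 0" by (auto simp: ln_ennreal_def split: if_splits)
    with 3 assms show ?thesis by simp
  next
    case 4
    then obtain x y where xy: "a = ennreal x" "a' = ennreal y" "x > 0" "y > 0"
      by (cases a; cases a') (auto simp: order.order_iff_strict)
    have exp_ln: "exp_ennreal (ereal l * ln_ennreal (ennreal z)) = ennreal (z powr l)"
      if "z > 0" for z
      using that by (simp add: ln_ennreal_def exp_ennreal_def powr_def ennreal_eq_0_iff)
    have "b + b' \<le> ennreal (x powr l) + ennreal (y powr l)"
      using assms xy by (intro add_mono) (simp_all add: ln_ennreal_le_iff exp_ln)
    also have "\<dots> = ennreal (x powr l + y powr l)" by simp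
    also have "\<dots> \<le> ennreal ((x + y) powr l)"
      using powr_superadditive[of x y l] xy assms by (intro ennreal_leI) auto
    also have "\<dots> = exp_ennreal (ereal l * ln_ennreal (a + a'))"
      using xy by (simp add: exp_ln flip: ennreal_plus)
    finally show ?thesis by (simp add: ln_ennreal_le_iff)
  qed
qed

lemma ln_ennreal_sum_le:
  assumes "l \<ge> 1" "\<And>i. i \<in> I \<Longrightarrow> ln_ennreal (b i) \<le> ereal l * ln_ennreal (a i)"
  shows "ln_ennreal (\<Sum>i\<in>I. b i) \<le> ereal l * ln_ennreal (\<Sum>i\<in>I. a i)"
  using assms(2)
proof (induction I rule: infinite_finite_induct)
  case (insert i I)
  then show ?case using assms(1) by (simp add: ln_ennreal_add_le)
\<comment> \<open>For an infinite or empty index set both sums are 0, and both sides are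
  \<open>-\<infinity>\<close> because \<open>l > 0\<close>.\<close>
qed (use assms(1) in \<open>auto simp: ln_ennreal_def\<close>)

lemma ln_ennreal_SUP_le:
  assumes "l > 0" "\<And>i. i \<in> I \<Longrightarrow> ln_ennreal (b i) \<le> ereal l * ln_ennreal (a i)"
  shows "ln_ennreal (SUP i\<in>I. b i) \<le> ereal l * ln_ennreal (SUP i\<in>I. a i)"
  unfolding ln_ennreal_le_iff
proof (rule SUP_least, fold ln_ennreal_le_iff)
  fix i assume i: "i \<in> I"
  then have "ereal l * ln_ennreal (a i) \<le> ereal l * ln_ennreal (SUP i\<in>I. a i)"
    using assms(1) by (intro ereal_mult_left_mono ln_ennreal_mono SUP_upper) auto
  with assms(2)[OF i] show "ln_ennreal (b i) \<le> ereal l * ln_ennreal (SUP i\<in>I. a i)"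
    by (rule order_trans)
qed

lemma ereal_le_mult_iff:
  fixes x y :: ereal
  assumes "l > 0"
  shows "x \<le> ereal l * y \<longleftrightarrow> ereal (1 / l) * x \<le> y"
  using assms by (cases x; cases y) (auto simp: field_simps)

text \<open>Once \<open>l\<close> is moved to the left and the logarithm undone, the claim is that a
  constant is a lower bound of all \<open>a i\<close>.\<close>

lemma ln_ennreal_INF_le:
  assumes "l > 0" "\<And>i. i \<in> I \<Longrightarrow> ln_ennreal (b i) \<le> ereal l * ln_ennreal (a i)"
  shows "ln_ennreal (INF i\<in>I. b i) \<le> ereal l * ln_ennreal (INF i\<in>I. a i)"
proof -
  have "exp_ennreal (ereal (1 / l) * ln_ennreal (INF i\<in>I. b i)) \<le> a i" if i: "i \<in> I" for i
  proof -
    have "ln_ennreal (INF i\<in>I. b i) \<le> ln_ennreal (b i)"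
      using i by (intro ln_ennreal_mono INF_lower)
    also note assms(2)[OF i]
    finally show ?thesis
      by (simp only: ereal_le_mult_iff[OF assms(1)] le_ln_ennreal_iff)
  qed
  then show ?thesis
    unfolding ereal_le_mult_iff[OF assms(1)] le_ln_ennreal_iff by (intro INF_greatest)
qed

lemma infsum_ennreal_eq_SUP:
  fixes f :: "'b \<Rightarrow> ennreal"
  shows "infsum f A = (SUP F\<in>{F. finite F \<and> F \<subseteq> A}. sum f F)"
  by (rule nonneg_infsum_complete) simp

lemma ln_ennreal_infsum_le:
  fixes a b :: "'b \<Rightarrow> ennreal"
  assumes "l \<ge> 1" "\<And>i. i \<in> I \<Longrightarrow> ln_ennreal (b i) \<le> ereal l * ln_ennreal (a i)"
  shows "ln_ennreal (infsum b I) \<le> ereal l * ln_ennreal (infsum a I)"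
  unfolding infsum_ennreal_eq_SUP using assms
  by (intro ln_ennreal_SUP_le ln_ennreal_sum_le) auto

text \<open>On a finite subset \<open>F\<close> each \<open>g x\<close> is at most
  \<open>sum g F\<close>, which then factors out.\<close>

lemma infsum_ennreal_mult_le:
  fixes f g :: "'b \<Rightarrow> ennreal"
  shows "infsum (\<lambda>x. f x * g x) A \<le> infsum f A * infsum g A"
  unfolding infsum_ennreal_eq_SUP[of "\<lambda>x. f x * g x"]
proof (rule SUP_least)
  fix F assume F: "F \<in> {F. finite F \<and> F \<subseteq> A}"
  have "(\<Sum>x\<in>F. f x * g x) \<le> (\<Sum>x\<in>F. f x * sum g F)"
    using F by (intro sum_mono mult_left_mono member_le_sum) auto
  also have "\<dots> = sum f F * sum g F" by (simp add: sum_distrib_right)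
  also have "\<dots> \<le> infsum f A * infsum g A"
    unfolding infsum_ennreal_eq_SUP using F by (intro mult_mono SUP_upper) auto
  finally show "(\<Sum>x\<in>F. f x * g x) \<le> infsum f A * infsum g A" .
qed

lemma infsum_ennreal_ge:
  fixes f :: "'b \<Rightarrow> ennreal"
  assumes "x \<in> A"
  shows "f x \<le> infsum f A"
  unfolding infsum_ennreal_eq_SUP using assms by (intro SUP_upper2[of "{x}"]) auto

section \<open>Growth rates\<close>

lemma growth_rate_mono:
  assumes "\<And>n. a n \<le> b n"
  shows "growth_rate s a \<le> growth_rate s b"
  unfolding growth_rate_def using assms
  by (intro Limsup_mono always_eventually allI ereal_mult_left_mono ln_ennreal_mono) auto

lemma growth_rate_le_mult:
  assumes "l \<ge> 0" "\<And>n. ln_ennreal (b n) \<le> ereal l * ln_ennreal (a n)"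
  shows "growth_rate s b \<le> ereal l * growth_rate s a"
proof -
  have "growth_rate s b \<le> limsup (\<lambda>n. ereal l * (ereal (1 / real n powr s) * ln_ennreal (a n)))"
    unfolding growth_rate_def
  proof (intro Limsup_mono always_eventually allI)
    fix n
    have "ereal (1 / real n powr s) * ln_ennreal (b n)
        \<le> ereal (1 / real n powr s) * (ereal l * ln_ennreal (a n))"
      using assms(2) by (intro ereal_mult_left_mono) auto
    then show "ereal (1 / real n powr s) * ln_ennreal (b n)
        \<le> ereal l * (ereal (1 / real n powr s) * ln_ennreal (a n))"
      by (simp only: mult.left_commute)
  qed
  with assms(1) show ?thesis by (simp add: growth_rate_def limsup_ereal_mult_left)
qed

lemma growth_rate_mult_le: "growth_rate s (\<lambda>n. a n * b n) \<le> growth_rate s a + growth_rate s b"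
proof -
  have "growth_rate s (\<lambda>n. a n * b n) \<le> limsup (\<lambda>n. ereal (1 / real n powr s) * ln_ennreal (a n)
      + ereal (1 / real n powr s) * ln_ennreal (b n))"
    unfolding growth_rate_def
    \<comment> \<open>The factor \<open>1 / real n powr s\<close> is nonnegative and finite, so it
      distributes even over \<open>\<infinity> + (-\<infinity>)\<close>.\<close>
    by (intro Limsup_mono always_eventually allI)
      (auto simp flip: ereal_pos_distrib intro!: ereal_mult_left_mono ln_ennreal_mult_le)
  also have "\<dots> \<le> growth_rate s a + growth_rate s b"
    unfolding growth_rate_def by (rule ereal_limsup_add_mono)
  finally show ?thesis .
qed

lemma growth_rate_nonneg:
  assumes "\<And>n. 1 \<le> a n"
  shows "0 \<le> growth_rate s a"
proof -
  have "0 = growth_rate s (\<lambda>n. 1)"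
    by (simp add: growth_rate_def ln_ennreal_def Limsup_const flip: zero_ereal_def)
  also have "\<dots> \<le> growth_rate s a" by (rule growth_rate_mono) (rule assms)
  finally show ?thesis .
qed

section \<open>Pressures as suprema over the scale\<close>

text \<open>If \<open>f\<close> exceeds \<open>c\<close> at one scale, it does so at all smaller
  ones. This brings \<open>PD2\<close> and \<open>PD3\<close> into the same supremum form as
  \<open>PD1\<close> and \<open>PD4\<close>.\<close>

lemma Lim_at_right_antimono:
  fixes f :: "real \<Rightarrow> ereal"
  assumes "\<And>x y. 0 < x \<Longrightarrow> x \<le> y \<Longrightarrow> f y \<le> f x"
  shows "Lim (at_right 0) f = (SUP \<epsilon>\<in>{0<..}. f \<epsilon>)"
proof (rule tendsto_Lim)
  show "(f \<longlongrightarrow> (SUP \<epsilon>\<in>{0<..}. f \<epsilon>)) (at_right 0)"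
  proof (rule order_tendstoI)
    fix c assume "c < (SUP \<epsilon>\<in>{0<..}. f \<epsilon>)"
    then obtain \<delta> where \<delta>: "\<delta> > 0" "c < f \<delta>" by (auto simp: less_SUP_iff)
    then have "c < f \<epsilon>" if "0 < \<epsilon>" "\<epsilon> < \<delta>" for \<epsilon>
      using assms[of \<epsilon> \<delta>] that by (auto intro: order.strict_trans2)
    with \<delta>(1) show "eventually (\<lambda>\<epsilon>. c < f \<epsilon>) (at_right 0)"
      by (auto simp: eventually_at_right_field)
  next
    fix c assume c: "(SUP \<epsilon>\<in>{0<..}. f \<epsilon>) < c"
    have "f \<epsilon> < c" if "0 < \<epsilon>" for \<epsilon>
      using that by (intro le_less_trans[OF SUP_upper c]) auto
    then show "eventually (\<lambda>\<epsilon>. f \<epsilon> < c) (at_right 0)"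
      by (auto simp: eventually_at_right_field intro: exI[of _ 1])
  qed
qed simp

text \<open>A smaller scale admits fewer spanning sets, so the infimum grows.\<close>

lemma PD2_eq_SUP: "PD2 X s T \<phi> = (SUP \<epsilon>\<in>{0<..}. growth_rate s (Q_sum X T \<phi> \<epsilon>))"
  unfolding PD2_def
proof (intro Lim_at_right_antimono growth_rate_mono)
  fix \<epsilon> \<delta> :: real and n
  assume "\<epsilon> \<le> \<delta>"
  \<comment> \<open>The inclusion holds also at \<open>n = 0\<close>, where
    \<open>bowen_dist\<close> is the unspecified maximum of an empty set.\<close>
  then have "{F. spanning_set X T n \<epsilon> F} \<subseteq> {F. spanning_set X T n \<delta> F}"
    unfolding spanning_set_def by (blast intro: less_le_trans)
  then show "Q_sum X T \<phi> \<delta> n \<le> Q_sum X T \<phi> \<epsilon> n"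
    unfolding Q_sum_def by (rule INF_superset_mono) simp
qed

text \<open>A smaller scale admits more separated sets, so the supremum grows.\<close>

lemma PD3_eq_SUP: "PD3 X s T \<phi> = (SUP \<epsilon>\<in>{0<..}. growth_rate s (P_sum X T \<phi> \<epsilon>))"
  unfolding PD3_def
proof (intro Lim_at_right_antimono growth_rate_mono)
  fix \<epsilon> \<delta> :: real and n
  assume "\<epsilon> \<le> \<delta>"
  then have "{E. separated_set X T n \<delta> E} \<subseteq> {E. separated_set X T n \<epsilon> E}"
    unfolding separated_set_def by (auto intro: le_less_trans)
  then show "P_sum X T \<phi> \<delta> n \<le> P_sum X T \<phi> \<epsilon> n"
    unfolding P_sum_def by (rule SUP_subset_mono) simp
qed

section \<open>Sums and multiples of potentials\<close>

text \<open>Separation does not depend on the potential, so one set \<open>E\<close> competes in all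
  three suprema and the product bound holds at each \<open>n\<close> and scale.\<close>

lemma PD3_add_le: "PD3 X s T (\<lambda>n x. \<phi> n x + \<psi> n x) \<le> PD3 X s T \<phi> + PD3 X s T \<psi>"
  unfolding PD3_eq_SUP[of X s T "\<lambda>n x. \<phi> n x + \<psi> n x"]
proof (rule SUP_least)
  fix \<epsilon> :: real assume \<epsilon>: "\<epsilon> \<in> {0<..}"
  have "P_sum X T (\<lambda>n x. \<phi> n x + \<psi> n x) \<epsilon> n \<le> P_sum X T \<phi> \<epsilon> n * P_sum X T \<psi> \<epsilon> n" for n
    unfolding P_sum_def[of X T "\<lambda>n x. \<phi> n x + \<psi> n x"]
  proof (rule SUP_least)
    fix E assume E: "E \<in> {E. separated_set X T n \<epsilon> E}"
    have "(\<Sum>\<^sub>\<infinity>x\<in>E. ennreal (exp (\<phi> n x + \<psi> n x)))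
        \<le> (\<Sum>\<^sub>\<infinity>x\<in>E. ennreal (exp (\<phi> n x))) * (\<Sum>\<^sub>\<infinity>x\<in>E. ennreal (exp (\<psi> n x)))"
      using infsum_ennreal_mult_le[of "\<lambda>x. ennreal (exp (\<phi> n x))" "\<lambda>x. ennreal (exp (\<psi> n x))" E]
      by (simp add: exp_add ennreal_mult)
    also have "\<dots> \<le> P_sum X T \<phi> \<epsilon> n * P_sum X T \<psi> \<epsilon> n"
      unfolding P_sum_def using E by (intro mult_mono SUP_upper) auto
    finally show "(\<Sum>\<^sub>\<infinity>x\<in>E. ennreal (exp (\<phi> n x + \<psi> n x))) \<le> P_sum X T \<phi> \<epsilon> n * P_sum X T \<psi> \<epsilon> n" .
  qed
  then have "growth_rate s (P_sum X T (\<lambda>n x. \<phi> n x + \<psi> n x) \<epsilon>)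
      \<le> growth_rate s (\<lambda>n. P_sum X T \<phi> \<epsilon> n * P_sum X T \<psi> \<epsilon> n)"
    by (rule growth_rate_mono)
  also have "\<dots> \<le> growth_rate s (P_sum X T \<phi> \<epsilon>) + growth_rate s (P_sum X T \<psi> \<epsilon>)"
    by (rule growth_rate_mult_le)
  also have "\<dots> \<le> PD3 X s T \<phi> + PD3 X s T \<psi>"
    unfolding PD3_eq_SUP using \<epsilon> by (intro add_mono SUP_upper)
  finally show "growth_rate s (P_sum X T (\<lambda>n x. \<phi> n x + \<psi> n x) \<epsilon>) \<le> PD3 X s T \<phi> + PD3 X s T \<psi>" .
qed

text \<open>The index is a cover for \<open>PD1\<close> and \<open>PD4\<close>, and a scale for
  \<open>PD2\<close> and \<open>PD3\<close>.\<close>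

lemma SUP_growth_rate_le_mult:
  assumes "l \<ge> 0" "\<And>i n. i \<in> I \<Longrightarrow> ln_ennreal (b i n) \<le> ereal l * ln_ennreal (a i n)"
  shows "(SUP i\<in>I. growth_rate s (b i)) \<le> ereal l * (SUP i\<in>I. growth_rate s (a i))"
proof (rule SUP_least)
  fix i assume i: "i \<in> I"
  have "growth_rate s (b i) \<le> ereal l * growth_rate s (a i)"
    using assms i by (intro growth_rate_le_mult) auto
  also have "\<dots> \<le> ereal l * (SUP i\<in>I. growth_rate s (a i))"
    using assms(1) i by (intro ereal_mult_left_mono SUP_upper) auto
  finally show "growth_rate s (b i) \<le> ereal l * (SUP i\<in>I. growth_rate s (a i))" .
qed

lemma PD_mult_le:
  assumes "l \<ge> 1" "PD \<in> {PD1, PD2, PD3, PD4}"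
  shows "PD X s T (\<lambda>n x. l * \<phi> n x) \<le> ereal l * PD X s T \<phi>"
proof -
  have l: "l > 0" "l \<ge> 0" using assms(1) by auto
  \<comment> \<open>Here equality holds; the transfer lemmas carry the relation outward through each
    layer of sums, infima and suprema.\<close>
  have pt: "ln_ennreal (ennreal (exp (l * \<phi> n x))) \<le> ereal l * ln_ennreal (ennreal (exp (\<phi> n x)))"
    for n x by (simp add: ln_ennreal_exp)
  have "PD1 X s T (\<lambda>n x. l * \<phi> n x) \<le> ereal l * PD1 X s T \<phi>"
    unfolding PD1_def q_sum_def
    by (intro SUP_growth_rate_le_mult ln_ennreal_INF_le ln_ennreal_sum_le l assms(1) pt)
  moreover have "PD2 X s T (\<lambda>n x. l * \<phi> n x) \<le> ereal l * PD2 X s T \<phi>"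
    unfolding PD2_eq_SUP Q_sum_def
    by (intro SUP_growth_rate_le_mult ln_ennreal_INF_le ln_ennreal_infsum_le l assms(1) pt)
  moreover have "PD3 X s T (\<lambda>n x. l * \<phi> n x) \<le> ereal l * PD3 X s T \<phi>"
    unfolding PD3_eq_SUP P_sum_def
    by (intro SUP_growth_rate_le_mult ln_ennreal_SUP_le ln_ennreal_infsum_le l assms(1) pt)
  moreover have "PD4 X s T (\<lambda>n x. l * \<phi> n x) \<le> ereal l * PD4 X s T \<phi>"
    unfolding PD4_def p_sum_def
    by (intro SUP_growth_rate_le_mult ln_ennreal_INF_le ln_ennreal_SUP_le ln_ennreal_sum_le
        l assms(1) pt)
  ultimately show ?thesis using assms(2) by blast
qed

text \<open>A cover of a nonempty set has a nonempty member. The bound is asked of nonempty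
  \<open>B\<close> only, since an empty \<open>B\<close> contributes 0 to
  \<open>p_sum\<close>.\<close>

lemma subcover_sum_ge_1:
  assumes "X \<noteq> {}" "\<And>B. B \<noteq> {} \<Longrightarrow> (1::ennreal) \<le> f B"
  shows "1 \<le> (INF \<beta>\<in>finite_subcovers X \<gamma>. \<Sum>B\<in>\<beta>. f B)"
proof (rule INF_greatest)
  fix \<beta> assume "\<beta> \<in> finite_subcovers X \<gamma>"
  then have \<beta>: "finite \<beta>" "\<Union>\<beta> = X" by (auto simp: finite_subcovers_def)
  with assms(1) obtain B where "B \<in> \<beta>" "B \<noteq> {}" by blast
  then have "1 \<le> f B" using assms(2) by blast
  also have "\<dots> \<le> (\<Sum>B\<in>\<beta>. f B)" using \<beta> \<open>B \<in> \<beta>\<close> by (intro member_le_sum) auto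
  finally show "1 \<le> (\<Sum>B\<in>\<beta>. f B)" .
qed

text \<open>This serves the case \<open>l = 0\<close>. As the pressures are suprema, the single
  cover \<open>{X}\<close> or the single scale 1 suffices.\<close>

lemma PD_zero_nonneg:
  fixes X :: "'a::metric_space set"
  assumes "X \<noteq> {}" "PD \<in> {PD1, PD2, PD3, PD4}"
  shows "0 \<le> PD X s T (\<lambda>n x. 0)"
proof -
  have cover: "{X} \<in> finite_open_covers X" by (simp add: finite_open_covers_def)
  have "1 \<le> q_sum X T (\<lambda>n x. 0) {X} n" for n
    unfolding q_sum_def using assms(1) by (rule subcover_sum_ge_1) simp
  then have "0 \<le> PD1 X s T (\<lambda>n x. 0)"
    unfolding PD1_def by (intro SUP_upper2[OF cover] growth_rate_nonneg)
  moreover have "1 \<le> p_sum X T (\<lambda>n x. 0) {X} n" for n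
    unfolding p_sum_def using assms(1) by (rule subcover_sum_ge_1) simp
  then have "0 \<le> PD4 X s T (\<lambda>n x. 0)"
    unfolding PD4_def by (intro SUP_upper2[OF cover] growth_rate_nonneg)
  moreover have "1 \<le> Q_sum X T (\<lambda>n x. 0) 1 n" for n
    unfolding Q_sum_def
  proof (rule INF_greatest)
    fix F assume "F \<in> {F. spanning_set X T n 1 F}"
    with assms(1) obtain x where "x \<in> F" unfolding spanning_set_def by blast
    from infsum_ennreal_ge[OF this, of "\<lambda>_. 1"] show "1 \<le> (\<Sum>\<^sub>\<infinity>x\<in>F. ennreal (exp 0))" by simp
  qed
  then have "0 \<le> PD2 X s T (\<lambda>n x. 0)"
    unfolding PD2_eq_SUP by (intro SUP_upper2[of 1] growth_rate_nonneg) auto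
  moreover obtain x where x: "x \<in> X" using assms(1) by blast
  then have "1 \<le> P_sum X T (\<lambda>n x. 0) 1 n" for n
    \<comment> \<open>A one-point set is vacuously separated, and its sum is 1.\<close>
    unfolding P_sum_def by (intro SUP_upper2[of "{x}"]) (auto simp: separated_set_def)
  then have "0 \<le> PD3 X s T (\<lambda>n x. 0)"
    unfolding PD3_eq_SUP by (intro SUP_upper2[of 1] growth_rate_nonneg) auto
  ultimately show ?thesis using assms(2) by blast
qed

lemma PD_mult_ge:
  fixes X :: "'a::metric_space set"
  assumes "X \<noteq> {}" "0 \<le> l" "l \<le> 1" "PD \<in> {PD1, PD2, PD3, PD4}"
  shows "ereal l * PD X s T \<phi> \<le> PD X s T (\<lambda>n x. l * \<phi> n x)"
proof (cases "l = 0")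
  case True
  \<comment> \<open>The left side is 0 even for an infinite pressure, as
    \<open>0 * (\<plusminus>\<infinity>) = 0\<close>.\<close>
  with PD_zero_nonneg[OF assms(1,4)] show ?thesis by (simp flip: zero_ereal_def)
next
  case False
  with assms have l: "l > 0" "1 / l \<ge> 1" by auto
  have "PD X s T (\<lambda>n x. 1 / l * (l * \<phi> n x)) \<le> ereal (1 / l) * PD X s T (\<lambda>n x. l * \<phi> n x)"
    using l(2) assms(4) by (rule PD_mult_le)
  then have "PD X s T \<phi> \<le> ereal (1 / l) * PD X s T (\<lambda>n x. l * \<phi> n x)"
    using l(1) by simp
  \<comment> \<open>The equivalence is used with \<open>1 / l\<close> as its factor, so the factor
    \<open>1 / (1 / l) = l\<close> appears on the left.\<close>
  with l(1) show ?thesis by (subst (asm) ereal_le_mult_iff) auto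
qed

theorem theorem3p2:
  fixes X :: "'a::metric_space set"
    and T :: "'a \<Rightarrow> 'a"
    and s :: real
    and \<phi> \<psi> :: "nat \<Rightarrow> 'a \<Rightarrow> real"
  assumes "topological_dynamical_system X T"
    and "s > 0"
    and "almost_additive X T \<phi>"
    and "almost_additive X T \<psi>"
  shows "PD3 X s T (\<lambda>n x. \<phi> n x + \<psi> n x) \<le> PD3 X s T \<phi> + PD3 X s T \<psi> \<and>
    (\<forall>PD\<in>{PD1, PD2, PD3, PD4}. \<forall>l::real.
       (l \<ge> 1 \<longrightarrow> PD X s T (\<lambda>n x. l * \<phi> n x) \<le> ereal l * PD X s T \<phi>) \<and>
       (0 \<le> l \<and> l \<le> 1 \<longrightarrow> PD X s T (\<lambda>n x. l * \<phi> n x) \<ge> ereal l * PD X s T \<phi>))"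
proof -
  have "X \<noteq> {}" using assms(1) by (simp add: topological_dynamical_system_def)
  then show ?thesis
    using PD3_add_le[of X s T \<phi> \<psi>] PD_mult_le[of _ _ X s T \<phi>] PD_mult_ge[of X _ _ s T \<phi>]
    by blast
qed

end
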